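(* Let $G=(V,E,l)$ be a finite connected undirected simple metric graph and let $v^*\in V$. For $v\in V$ let $$\mathcal A_v=\{\,|\omega|_l:\omega\text{ is a finite walk from }v^*\text{ to }v\,\}.$$ Then, for every vertex $v\in V$, the set $\mathcal A_v$ coincides with the set of birth times at $v$ in the branched dynamics $\mathcal W(G,v^* )$.
   Context: A metric graph $G=(V,E,l)$ is a graph $(V,E)$ with a length function $l:E\to\mathbb R_{>0}$; each edge $e$ is identified with an interval of length $l(e)$. Graphs are undirected and simple (no loops, at most one edge between two vertices). Each edge $\{u,w\}$ gives two oriented edges $u\to w$ and $w\to u$. A finite walk from $v^*$ to $v$ is a finite sequence of vertices $\omega=(v_0,\dots,v_n)$ with $v_0=v^*$, $v_n=v$ and $\{v_{i-1},v_i\}\in E$ for $i=1,\dots,n$; its metric length is $|\omega|_l=\sum_{i=1}^n l(\{v_{i-1},v_i\})$. The empty walk at $v^*$, of length $0$, is included, so $0\in\mathcal A_{v^*}$. The dynamics $\mathcal W(G,v^* )$ (time $t\in\mathbb R_{\ge 0}$, space $V\cup\bigsqcup_{e\in E}e$): each moving point lies on an oriented edge and moves at unit speed toward its head. When a moving point reaches a vertex $v$ at time $t$, it is removed and new moving points are created at $v$, one on each oriented edge issuing from $v$ (including the reverse of the edge along which it arrived), each moving away from $v$ at unit speed; such a time $t$ is called a birth time at $v$. At time $0$ moving points are created at $v^*$ on all oriented edges issuing from $v^*$, and time $0$ is also counted as a birth time at $v^*$. *)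

theory Defs
  imports Complex_Main
begin

text \<open>
  The simple undirected graph underlying a metric graph has vertex set \<open>V\<close> and edges given as
  two-element subsets of \<open>V\<close>. The values of \<open>l\<close> outside \<open>E\<close> are irrelevant.
\<close>

definition is_walk :: "'v set \<Rightarrow> 'v set set \<Rightarrow> 'v \<Rightarrow> 'v \<Rightarrow> 'v list \<Rightarrow> bool" where
  "is_walk V E u w p \<longleftrightarrow>
     p \<noteq> [] \<and> set p \<subseteq> V \<and> hd p = u \<and> last p = w \<and>
     (\<forall>i. Suc i < length p \<longrightarrow> {p ! i, p ! Suc i} \<in> E)"

definition metric_length :: "('v set \<Rightarrow> real) \<Rightarrow> 'v list \<Rightarrow> real" where
  "metric_length l p = (\<Sum>i < length p - 1. l {p ! i, p ! Suc i})"

locale finite_connected_metric_graph =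
  fixes V :: "'v set" and E :: "'v set set" and l :: "'v set \<Rightarrow> real"
  assumes finite_vertices: "finite V"
    and simple_edges: "\<And>e. e \<in> E \<Longrightarrow> e \<subseteq> V \<and> card e = 2"
    and length_pos: "\<And>e. e \<in> E \<Longrightarrow> l e > 0"
    and connected: "\<And>u w. u \<in> V \<Longrightarrow> w \<in> V \<Longrightarrow> \<exists>p. is_walk V E u w p"

definition walk_lengths ::
  "'v set \<Rightarrow> 'v set set \<Rightarrow> ('v set \<Rightarrow> real) \<Rightarrow> 'v \<Rightarrow> 'v \<Rightarrow> real set" where
  "walk_lengths V E l v0 v = {metric_length l p | p. is_walk V E v0 v p}"

text \<open>
  \<open>moving_point E l v0 t u w x\<close>: in the dynamics started at \<open>v0\<close>, there is at time \<open>t\<close> a moving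
  point on the oriented edge \<open>u \<rightarrow> w\<close> at distance \<open>x\<close> from the tail \<open>u\<close>. The arrival position
  \<open>x = l {u, w}\<close> is kept at the single instant of arrival, so that an arrival is visible in the
  state; the bound in \<open>motion\<close> then makes the point disappear. Points occupying the same place on
  the same oriented edge at the same time are not distinguished.
\<close>

inductive moving_point ::
  "'v set set \<Rightarrow> ('v set \<Rightarrow> real) \<Rightarrow> 'v \<Rightarrow> real \<Rightarrow> 'v \<Rightarrow> 'v \<Rightarrow> real \<Rightarrow> bool"
  for E :: "'v set set" and l :: "'v set \<Rightarrow> real" and v0 :: 'v where
  initial: "{v0, w} \<in> E \<Longrightarrow> moving_point E l v0 0 v0 w 0"
| motion: "moving_point E l v0 t u w x \<Longrightarrow> 0 \<le> d \<Longrightarrow> x + d \<le> l {u, w} \<Longrightarrow>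
    moving_point E l v0 (t + d) u w (x + d)"
| branching: "moving_point E l v0 t u v (l {u, v}) \<Longrightarrow> {v, w} \<in> E \<Longrightarrow>
    moving_point E l v0 t v w 0"

definition reaches :: "'v set set \<Rightarrow> ('v set \<Rightarrow> real) \<Rightarrow> 'v \<Rightarrow> real \<Rightarrow> 'v \<Rightarrow> bool" where
  "reaches E l v0 t v \<longleftrightarrow> (\<exists>u. moving_point E l v0 t u v (l {u, v}))"

definition birth_times :: "'v set set \<Rightarrow> ('v set \<Rightarrow> real) \<Rightarrow> 'v \<Rightarrow> 'v \<Rightarrow> real set" where
  "birth_times E l v0 v = {t. reaches E l v0 t v \<or> (t = 0 \<and> v = v0)}"

end

theory Submission imports Defs begin

text \<open>
  Along the evolution of a moving point on \<open>u \<rightarrow> w\<close>, the time minus the position is constant and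
  equal to the time at which the point was created at \<open>u\<close>. This creation time is the length of a
  walk to \<open>u\<close>, because each branching appends one traversed edge. Conversely, a walk is followed
  edge by edge by a chain of moving points.
\<close>

text \<open>Walks are extended at their end because branching takes place at the head of the edge
  just traversed.\<close>

lemma is_walk_snoc_iff:
  assumes "p \<noteq> []"
  shows "is_walk V E u w (p @ [x]) \<longleftrightarrow>
    x = w \<and> w \<in> V \<and> is_walk V E u (last p) p \<and> {last p, w} \<in> E"
proof -
  have steps: "(\<forall>i. Suc i < length (p @ [x]) \<longrightarrow> {(p @ [x]) ! i, (p @ [x]) ! Suc i} \<in> E) \<longleftrightarrow>
    (\<forall>i. Suc i < length p \<longrightarrow> {p ! i, p ! Suc i} \<in> E) \<and> {last p, x} \<in> E" (is "?L \<longleftrightarrow> ?R")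
  proof
    assume L: ?L
    have "{p ! i, p ! Suc i} \<in> E" if "Suc i < length p" for i
      using L[rule_format, of i] that by (simp add: nth_append)
    moreover have "{last p, x} \<in> E"
      \<comment> \<open>The index \<open>length p - 1\<close> is the only one whose step crosses
        from \<open>p\<close> to \<open>x\<close>.\<close>
      using L[rule_format, of "length p - 1"] assms by (simp add: nth_append last_conv_nth)
    ultimately show ?R by blast
  next
    assume R: ?R
    show ?L
    proof (intro allI impI)
      fix i assume "Suc i < length (p @ [x])"
      then consider "Suc i < length p" | "i = length p - 1" "Suc i = length p"
        using assms by fastforce
      then show "{(p @ [x]) ! i, (p @ [x]) ! Suc i} \<in> E"
        using R assms by cases (simp_all add: nth_append last_conv_nth)
    qed
  qed
  show ?thesis
    unfolding is_walk_def steps using assms by auto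
qed

lemma metric_length_snoc:
  assumes "p \<noteq> []"
  shows "metric_length l (p @ [x]) = metric_length l p + l {last p, x}"
proof -
  \<comment> \<open>The truncated bound \<open>length p - 1\<close> becomes \<open>n\<close>, so the
    longer sum splits off its last term.\<close>
  obtain n where n: "length p = Suc n"
    using assms by (cases p) auto
  have "metric_length l (p @ [x]) = (\<Sum>i<Suc n. l {(p @ [x]) ! i, (p @ [x]) ! Suc i})"
    by (simp add: metric_length_def n)
  also have "\<dots> = (\<Sum>i<n. l {p ! i, p ! Suc i}) + l {last p, x}"
    using n assms by (simp add: nth_append last_conv_nth)
  finally show ?thesis
    by (simp add: metric_length_def n)
qed

lemma walk_lengths_self: "v0 \<in> V \<Longrightarrow> 0 \<in> walk_lengths V E l v0 v0"
  by (force simp: walk_lengths_def is_walk_def metric_length_def intro!: exI[of _ "[v0]"])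

lemma walk_lengths_step:
  assumes "a \<in> walk_lengths V E l v0 u" "{u, w} \<in> E" "w \<in> V"
  shows "a + l {u, w} \<in> walk_lengths V E l v0 w"
proof -
  obtain p where p: "is_walk V E v0 u p" "a = metric_length l p"
    using assms(1) by (auto simp: walk_lengths_def)
  then have "p \<noteq> []" "last p = u"
    by (auto simp: is_walk_def)
  then show ?thesis
    using p assms(2,3) is_walk_snoc_iff[of p V E v0 w w] metric_length_snoc[of p l w]
    by (auto simp: walk_lengths_def intro!: exI[of _ "p @ [w]"])
qed

text \<open>By rule induction; the edge conjunct is carried along so that in the branching case the
  walk to the tail can be extended over the edge just completed.\<close>

lemma moving_point_creation_time:
  assumes "moving_point E l v0 t u w x" "v0 \<in> V" "\<And>e. e \<in> E \<Longrightarrow> e \<subseteq> V"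
  shows "{u, w} \<in> E \<and> t - x \<in> walk_lengths V E l v0 u"
  using assms(1)
proof induction
  case (initial w)
  then show ?case using walk_lengths_self assms(2) by force
next
  case (motion t u w x d)
  then show ?case by simp
next
  case (branching t u v w)
  then have "v \<in> V" using assms(3) by blast
  then show ?case using branching walk_lengths_step[of "t - l {u, v}" V E l v0 u v] by simp
qed

lemma moving_point_created_at_birth_time:
  assumes "t \<in> birth_times E l v0 u" "{u, w} \<in> E"
  shows "moving_point E l v0 t u w 0"
  using assms by (auto simp: birth_times_def reaches_def intro: moving_point.intros)

lemma birth_times_step:
  assumes "t \<in> birth_times E l v0 u" "{u, w} \<in> E" "0 \<le> l {u, w}"
  shows "t + l {u, w} \<in> birth_times E l v0 w"
  \<comment> \<open>Unifying with \<open>assms(3)\<close> chooses \<open>d = l {u, w}\<close>: from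
    position 0 the point moves exactly to the arrival position that \<open>reaches\<close> looks
    for.\<close>
  using moving_point.motion[OF moving_point_created_at_birth_time[OF assms(1,2)] assms(3)]
  by (auto simp: birth_times_def reaches_def)

text \<open>Induction removes the last vertex: the shorter walk gives a birth at its endpoint, and
  the point created there crosses the final edge.\<close>

lemma metric_length_birth_time:
  assumes "is_walk V E v0 v p" "\<And>e. e \<in> E \<Longrightarrow> 0 \<le> l e"
  shows "metric_length l p \<in> birth_times E l v0 v"
  using assms(1)
proof (induction p arbitrary: v rule: rev_induct)
  case Nil
  then show ?case by (simp add: is_walk_def)
next
  case (snoc x p)
  show ?case
  proof (cases "p = []")
    case True
    then show ?thesis
      \<comment> \<open>A one-vertex walk has an empty sum as its length, which is the conventional
        birth time 0 at \<open>v0\<close>.\<close>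
      using snoc.prems by (auto simp: is_walk_def metric_length_def birth_times_def)
  next
    case False
    then have "x = v" "is_walk V E v0 (last p) p" "{last p, v} \<in> E"
      using snoc.prems is_walk_snoc_iff by metis+
    then show ?thesis
      using birth_times_step[OF snoc.IH] assms(2) metric_length_snoc[OF False] by metis
  qed
qed

theorem lemma3p1:
  fixes V :: "'v set" and E :: "'v set set" and l :: "'v set \<Rightarrow> real" and v0 :: 'v
  assumes "finite_connected_metric_graph V E l"
    and "v0 \<in> V"
  shows "\<forall>v\<in>V. walk_lengths V E l v0 v = birth_times E l v0 v"
proof (intro ballI equalityI subsetI)
  interpret finite_connected_metric_graph V E l by fact
  fix v t
  assume "v \<in> V"
  show "t \<in> birth_times E l v0 v" if "t \<in> walk_lengths V E l v0 v"
    using that metric_length_birth_time[OF _ less_imp_le[OF length_pos]]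
    by (auto simp: walk_lengths_def)
  show "t \<in> walk_lengths V E l v0 v" if "t \<in> birth_times E l v0 v"
  proof -
    consider u where "moving_point E l v0 t u v (l {u, v})" | "t = 0" "v = v0"
      using \<open>t \<in> birth_times E l v0 v\<close> by (auto simp: birth_times_def reaches_def)
    then show ?thesis
    proof cases
      case 1
      \<comment> \<open>At arrival the position is \<open>l {u, v}\<close>, so
        \<open>t - l {u, v}\<close> is the creation time at \<open>u\<close>.\<close>
      then have "{u, v} \<in> E" "t - l {u, v} \<in> walk_lengths V E l v0 u"
        using moving_point_creation_time \<open>v0 \<in> V\<close> simple_edges by metis+
      then show ?thesis
        using walk_lengths_step[of "t - l {u, v}"] \<open>v \<in> V\<close> by fastforce
    next
      case 2
      then show ?thesis using walk_lengths_self \<open>v0 \<in> V\<close> by simp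
    qed
  qed
qed

end
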